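(* Let $G$ be a finite group, let $T\le H\le G$ be subgroups, and let $w$ be a weight on $G$. The left ideal $L=\mathbb{C}[G]\eta_T$ is a weak lumping Gurvits--Ledoux ideal for $w$ with respect to left cosets of $H$ if and only if (a) the left-invariant random walk driven by $w$ lumps exactly to left cosets of $T$, and (b) $w(TgH)=\dfrac{|TgH|}{|HgH|}\,w(HgH)$ for all $TgH\in T\backslash G/H$.
   Context: A weight on $G$ is a function $w:G\to\mathbb{R}_{\ge0}$, not identically zero, identified with $\sum_gw(g)g\in\mathbb{C}[G]$; $w(K)=\sum_{g\in K}w(g)$ for $K\subseteq G$; $\eta_K=|K|^{-1}\sum_{g\in K}g$. Let $\pi_H:\mathbb{C}[G]\to\mathbb{C}[H]$ be the projection $\sum_{g\in G}x(g)g\mapsto\sum_{g\in H}x(g)g$. A left ideal $L$ of $\mathbb{C}[G]$ is a Gurvits--Ledoux ideal for $w$ (with respect to left cosets of $H$) if $\eta_G\in L$, $Lw\subseteq L$ and $\pi_H(L)\subseteq L$; it is weak lumping if moreover $L^\circ w\subseteq L^\circ$, where $L^\circ=L(1-\eta_H)$ is the set of elements of $L$ whose coefficients sum to $0$ over each left coset of $H$. The left-invariant random walk driven by $w$ is the Markov chain on $G$ with transition probabilities $P(x,y)=w(x^{-1}y)/w(G)$. It lumps exactly to left cosets of $T$ if the minimal subspace of $\mathbb{R}^G$ that contains the uniform distribution on $G$ and is closed under right multiplication by $P$ (equivalently, by $w$) and under each coordinate projection onto a left coset of $T$, contains no non-zero vector whose coordinates sum to $0$ over every left coset of $T$. *)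

theory Defs
  imports
    Complex_Main
    "HOL-Library.Function_Algebras"
    "HOL-Algebra.Coset"
    "HOL-Algebra.Left_Coset"
    "HOL-Algebra.AbelCoset"
begin

section \<open>The group algebra\<close>

text \<open>The element \<open>\<Sum>g. x(g) g\<close> of \<open>\<complex>[G]\<close> is represented by its coefficient function \<open>x\<close>,
  which vanishes outside the carrier.\<close>

definition group_algebra :: "('a, 'b) monoid_scheme \<Rightarrow> ('a \<Rightarrow> complex) ring" where
  "group_algebra G =
    \<lparr>carrier = {x. \<forall>g. g \<notin> carrier G \<longrightarrow> x g = 0},
     mult = (\<lambda>x y g. if g \<in> carrier G
              then (\<Sum>h\<in>carrier G. x h * y (inv\<^bsub>G\<^esub> h \<otimes>\<^bsub>G\<^esub> g)) else 0),
     one = (\<lambda>g. if g = \<one>\<^bsub>G\<^esub> then 1 else 0),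
     zero = (\<lambda>g. 0),
     add = (\<lambda>x y g. x g + y g)\<rparr>"

lemma group_algebra_mult_assoc:
  assumes "group G" and fin: "finite (carrier G)"
  shows "(x \<otimes>\<^bsub>group_algebra G\<^esub> y) \<otimes>\<^bsub>group_algebra G\<^esub> z =
         x \<otimes>\<^bsub>group_algebra G\<^esub> (y \<otimes>\<^bsub>group_algebra G\<^esub> z)"
proof -
  interpret group G by fact
  have cancel: "h \<otimes>\<^bsub>G\<^esub> (inv\<^bsub>G\<^esub> h \<otimes>\<^bsub>G\<^esub> k) = k"
      "inv\<^bsub>G\<^esub> h \<otimes>\<^bsub>G\<^esub> (h \<otimes>\<^bsub>G\<^esub> k) = k"
    if "h \<in> carrier G" "k \<in> carrier G" for h k
    using that by (simp_all add: m_assoc[symmetric])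
  have inner: "(\<Sum>k\<in>carrier G. y (inv\<^bsub>G\<^esub> h \<otimes>\<^bsub>G\<^esub> k) * z (inv\<^bsub>G\<^esub> k \<otimes>\<^bsub>G\<^esub> g)) =
      (\<Sum>k\<in>carrier G. y k * z (inv\<^bsub>G\<^esub> k \<otimes>\<^bsub>G\<^esub> (inv\<^bsub>G\<^esub> h \<otimes>\<^bsub>G\<^esub> g)))"
    if h: "h \<in> carrier G" and g: "g \<in> carrier G" for h g
    by (rule sum.reindex_bij_witness[of _ "\<lambda>k. h \<otimes>\<^bsub>G\<^esub> k" "\<lambda>k. inv\<^bsub>G\<^esub> h \<otimes>\<^bsub>G\<^esub> k"])
      (use h g in \<open>simp_all add: m_assoc inv_mult_group cancel\<close>)
  show ?thesis
  proof
    fix g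
    show "((x \<otimes>\<^bsub>group_algebra G\<^esub> y) \<otimes>\<^bsub>group_algebra G\<^esub> z) g =
         (x \<otimes>\<^bsub>group_algebra G\<^esub> (y \<otimes>\<^bsub>group_algebra G\<^esub> z)) g"
    proof (cases "g \<in> carrier G")
      case False
      then show ?thesis by (simp add: group_algebra_def)
    next
      case g: True
      have "((x \<otimes>\<^bsub>group_algebra G\<^esub> y) \<otimes>\<^bsub>group_algebra G\<^esub> z) g =
          (\<Sum>k\<in>carrier G. \<Sum>h\<in>carrier G.
             x h * (y (inv\<^bsub>G\<^esub> h \<otimes>\<^bsub>G\<^esub> k) * z (inv\<^bsub>G\<^esub> k \<otimes>\<^bsub>G\<^esub> g)))"
        using g by (simp add: group_algebra_def sum_distrib_right mult.assoc)
      also have "\<dots> = (\<Sum>h\<in>carrier G. x h *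
          (\<Sum>k\<in>carrier G. y (inv\<^bsub>G\<^esub> h \<otimes>\<^bsub>G\<^esub> k) * z (inv\<^bsub>G\<^esub> k \<otimes>\<^bsub>G\<^esub> g)))"
        by (subst sum.swap) (simp add: sum_distrib_left)
      also have "\<dots> = (\<Sum>h\<in>carrier G. x h *
          (\<Sum>k\<in>carrier G. y k * z (inv\<^bsub>G\<^esub> k \<otimes>\<^bsub>G\<^esub> (inv\<^bsub>G\<^esub> h \<otimes>\<^bsub>G\<^esub> g))))"
        using g by (intro sum.cong refl) (simp add: inner)
      also have "\<dots> = (x \<otimes>\<^bsub>group_algebra G\<^esub> (y \<otimes>\<^bsub>group_algebra G\<^esub> z)) g"
        using g by (simp add: group_algebra_def)
      finally show ?thesis .
    qed
  qed
qed

lemma ring_group_algebra: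
  assumes "group G" and fin: "finite (carrier G)"
  shows "ring (group_algebra G)"
proof -
  interpret group G by fact
  have inv_eq: "inv\<^bsub>G\<^esub> h \<otimes>\<^bsub>G\<^esub> g = \<one>\<^bsub>G\<^esub> \<longleftrightarrow> h = g"
    if "h \<in> carrier G" "g \<in> carrier G" for h g
    using that by (metis inv_closed inv_equality inv_inv l_inv)
  show ?thesis
  proof (rule ringI)
    show "abelian_group (group_algebra G)"
    proof (rule abelian_groupI)
      fix x assume "x \<in> carrier (group_algebra G)"
      then show "\<exists>y\<in>carrier (group_algebra G). y \<oplus>\<^bsub>group_algebra G\<^esub> x = \<zero>\<^bsub>group_algebra G\<^esub>"
        by (intro bexI[of _ "\<lambda>g. - x g"]) (auto simp: group_algebra_def)
    qed (auto simp: group_algebra_def add_ac)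
    show "Group.monoid (group_algebra G)"
    proof (rule monoidI)
      fix x assume x: "x \<in> carrier (group_algebra G)"
      show "\<one>\<^bsub>group_algebra G\<^esub> \<otimes>\<^bsub>group_algebra G\<^esub> x = x"
        using x fin by (auto simp: group_algebra_def fun_eq_iff if_distrib[of "\<lambda>t. t * _"]
            sum.delta cong: if_cong)
      show "x \<otimes>\<^bsub>group_algebra G\<^esub> \<one>\<^bsub>group_algebra G\<^esub> = x"
        using x fin by (auto simp: group_algebra_def fun_eq_iff inv_eq if_distrib[of "\<lambda>t. _ * t"]
            sum.delta cong: sum.cong if_cong)
    qed (auto simp: group_algebra_mult_assoc[OF assms], auto simp: group_algebra_def)
  qed (auto simp: group_algebra_def fun_eq_iff ring_distribs sum.distrib)
qed

text \<open>A left ideal of \<open>\<complex>[G]\<close> is automatically a complex subspace.\<close>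

definition left_ideal :: "'c set \<Rightarrow> ('c, 'd) ring_scheme \<Rightarrow> bool" where
  "left_ideal L R \<longleftrightarrow>
    additive_subgroup L R \<and> (\<forall>a\<in>carrier R. \<forall>x\<in>L. a \<otimes>\<^bsub>R\<^esub> x \<in> L)"

definition eta :: "'a set \<Rightarrow> 'a \<Rightarrow> complex" where
  "eta K = (\<lambda>g. if g \<in> K then 1 / of_nat (card K) else 0)"

text \<open>Coordinate projection onto \<open>K\<close>.  On \<open>\<complex>[G]\<close> with \<open>K = H\<close> it is \<open>\<pi>\<^sub>H\<close>, where \<open>\<complex>[H]\<close> is
  regarded as a subset of \<open>\<complex>[G]\<close>.\<close>

definition coord_proj :: "'a set \<Rightarrow> ('a \<Rightarrow> 'c::zero) \<Rightarrow> 'a \<Rightarrow> 'c" where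
  "coord_proj K x = (\<lambda>g. if g \<in> K then x g else 0)"


section \<open>Weights and Gurvits--Ledoux ideals\<close>

text \<open>Only the values of a weight on the carrier matter.\<close>

definition weight :: "('a, 'b) monoid_scheme \<Rightarrow> ('a \<Rightarrow> real) \<Rightarrow> bool" where
  "weight G w \<longleftrightarrow> (\<forall>g\<in>carrier G. w g \<ge> 0) \<and> (\<exists>g\<in>carrier G. w g \<noteq> 0)"

definition weight_elt :: "('a, 'b) monoid_scheme \<Rightarrow> ('a \<Rightarrow> real) \<Rightarrow> 'a \<Rightarrow> complex" where
  "weight_elt G w = (\<lambda>g. if g \<in> carrier G then complex_of_real (w g) else 0)"

definition GL_ideal ::
  "('a, 'b) monoid_scheme \<Rightarrow> 'a set \<Rightarrow> ('a \<Rightarrow> real) \<Rightarrow> ('a \<Rightarrow> complex) set \<Rightarrow> bool" where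
  "GL_ideal G H w L \<longleftrightarrow>
    left_ideal L (group_algebra G) \<and>
    eta (carrier G) \<in> L \<and>
    L #>\<^bsub>group_algebra G\<^esub> weight_elt G w \<subseteq> L \<and>
    coord_proj H ` L \<subseteq> L"

text \<open>\<open>L\<degree> = L(1 - \<eta>\<^sub>H)\<close>.\<close>

definition ideal_circ ::
  "('a, 'b) monoid_scheme \<Rightarrow> 'a set \<Rightarrow> ('a \<Rightarrow> complex) set \<Rightarrow> ('a \<Rightarrow> complex) set" where
  "ideal_circ G H L =
    L #>\<^bsub>group_algebra G\<^esub> (\<one>\<^bsub>group_algebra G\<^esub> \<ominus>\<^bsub>group_algebra G\<^esub> eta H)"

definition weak_lumping_GL_ideal ::
  "('a, 'b) monoid_scheme \<Rightarrow> 'a set \<Rightarrow> ('a \<Rightarrow> real) \<Rightarrow> ('a \<Rightarrow> complex) set \<Rightarrow> bool" where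
  "weak_lumping_GL_ideal G H w L \<longleftrightarrow>
    GL_ideal G H w L \<and>
    ideal_circ G H L #>\<^bsub>group_algebra G\<^esub> weight_elt G w \<subseteq> ideal_circ G H L"


section \<open>The random walk and exact lumping\<close>

definition walk_matrix :: "('a, 'b) monoid_scheme \<Rightarrow> ('a \<Rightarrow> real) \<Rightarrow> 'a \<Rightarrow> 'a \<Rightarrow> real" where
  "walk_matrix G w x y = w (inv\<^bsub>G\<^esub> x \<otimes>\<^bsub>G\<^esub> y) / sum w (carrier G)"

text \<open>\<open>\<real>\<^sup>G\<close>, as real functions that vanish outside the carrier.\<close>

definition real_vectors :: "('a, 'b) monoid_scheme \<Rightarrow> ('a \<Rightarrow> real) set" where
  "real_vectors G = {v. \<forall>g. g \<notin> carrier G \<longrightarrow> v g = 0}"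

text \<open>The row vector \<open>v P\<close>.\<close>

definition row_mult ::
  "('a, 'b) monoid_scheme \<Rightarrow> ('a \<Rightarrow> real) \<Rightarrow> ('a \<Rightarrow> 'a \<Rightarrow> real) \<Rightarrow> 'a \<Rightarrow> real" where
  "row_mult G v P = (\<lambda>y. if y \<in> carrier G then (\<Sum>x\<in>carrier G. v x * P x y) else 0)"

definition uniform_vec :: "('a, 'b) monoid_scheme \<Rightarrow> 'a \<Rightarrow> real" where
  "uniform_vec G = (\<lambda>g. if g \<in> carrier G then 1 / real (card (carrier G)) else 0)"

definition GL_subspaces ::
  "('a, 'b) monoid_scheme \<Rightarrow> 'a set \<Rightarrow> ('a \<Rightarrow> 'a \<Rightarrow> real) \<Rightarrow> ('a \<Rightarrow> real) set set" where
  "GL_subspaces G T P =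
    {V. V \<subseteq> real_vectors G \<and>
        module.subspace (\<lambda>(c::real) v x. c * v x) V \<and>
        uniform_vec G \<in> V \<and>
        (\<forall>v\<in>V. row_mult G v P \<in> V) \<and>
        (\<forall>C\<in>lcosets\<^bsub>G\<^esub> T. \<forall>v\<in>V. coord_proj C v \<in> V)}"

lemma module_real_fun: "module (\<lambda>(c::real) (v::'a \<Rightarrow> real) x. c * v x)"
  by unfold_locales (auto simp: fun_eq_iff algebra_simps)

lemma real_vectors_in_GL_subspaces:
  "real_vectors G \<in> GL_subspaces G T P"
  unfolding GL_subspaces_def module.subspace_def[OF module_real_fun]
  by (auto simp: real_vectors_def uniform_vec_def row_mult_def coord_proj_def)

lemma Inter_GL_subspaces:
  "\<Inter> (GL_subspaces G T P) \<in> GL_subspaces G T P"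
  using real_vectors_in_GL_subspaces[of G T P]
  unfolding GL_subspaces_def module.subspace_def[OF module_real_fun]
  by auto

text \<open>By the two preceding lemmas, the intersection below is the minimal subspace.\<close>

definition lumps_exactly ::
  "('a, 'b) monoid_scheme \<Rightarrow> 'a set \<Rightarrow> ('a \<Rightarrow> 'a \<Rightarrow> real) \<Rightarrow> bool" where
  "lumps_exactly G T P \<longleftrightarrow>
    (\<forall>v\<in>\<Inter> (GL_subspaces G T P). (\<forall>C\<in>lcosets\<^bsub>G\<^esub> T. sum v C = 0) \<longrightarrow> v = (\<lambda>g. 0))"

end

theory Submission
  imports Defs
begin

text \<open>
  Write \<open>e = \<eta>\<^sub>T\<close>, \<open>f = \<eta>\<^sub>H\<close>, \<open>A = \<complex>[G]\<close> and \<open>L = Ae\<close>.  As \<open>T \<le> H\<close>, these idempotents satisfy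
  \<open>ef = fe = f\<close>, and the theorem splits into two independent translations of equations between
  elements of \<open>A\<close>.

  \<^item> \<open>L\<close> contains \<open>\<eta>\<^sub>G\<close> and is stable under \<open>\<pi>\<^sub>H\<close> whatever \<open>w\<close> is, so \<open>L\<close> is a Gurvits--Ledoux ideal
    if and only if \<open>Lw \<subseteq> L\<close>, that is, if and only if \<open>e w e = e w\<close>.  The ideal \<open>L\<degree>\<close> is
    \<open>A(e - f)\<close>, so inside a Gurvits--Ledoux ideal it is stable under \<open>w\<close> if and only if
    \<open>(e - f) w f = 0\<close>, that is, \<open>e w f = f w f\<close> (lemma \<open>weak_lumping_eta_iff\<close>).

  \<^item> The minimal subspace in the definition of exact lumping contains the projections of the uniform
    distribution to left cosets of \<open>T\<close>, hence every vector that is constant on these cosets.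
    Each further vector of the subspace would differ from its averages over the cosets, and the
    difference would have sum \<open>0\<close> over every coset.  So the walk lumps exactly if and only if the
    vectors constant on left cosets of \<open>T\<close> are closed under right multiplication by \<open>w\<close>; the
    complex vectors of this kind form \<open>L\<close>, and the condition is again \<open>e w e = e w\<close>
    (lemma \<open>lumps_exactly_iff\<close>).

  \<^item> The coefficient of \<open>\<eta>\<^sub>K w f\<close> at \<open>g\<close> is the average of \<open>w\<close> over \<open>KgH\<close>, so that \<open>e w f = f w f\<close>
    says that \<open>w\<close> has the same average over \<open>TgH\<close> as over \<open>HgH\<close>, for all \<open>g\<close>
    (lemma \<open>eta_mult_eta_eq_iff\<close>).
\<close>

section \<open>The group algebra of a finite group\<close>

locale finite_group = group G for G (structure) +
  assumes finite_carrier: "finite (carrier G)"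
begin

abbreviation A :: "('a \<Rightarrow> complex) ring" where
  "A \<equiv> group_algebra G"

sublocale A: ring A
  by (rule ring_group_algebra[OF is_group finite_carrier])

lemma group_algebra_ext:
  assumes "x \<in> carrier A" "y \<in> carrier A" and "\<And>g. g \<in> carrier G \<Longrightarrow> x g = y g"
  shows "x = y"
proof
  fix g show "x g = y g"
    using assms by (cases "g \<in> carrier G") (simp_all add: group_algebra_def)
qed

section \<open>Averaging idempotents\<close>

lemma eta_closed [simp]:
  assumes "K \<subseteq> carrier G"
  shows "eta K \<in> carrier A"
  using assms by (auto simp: group_algebra_def eta_def)

lemma weight_elt_closed [simp]: "weight_elt G w \<in> carrier A"
  by (simp add: group_algebra_def weight_elt_def)

lemma finite_subgroup: "subgroup K G \<Longrightarrow> finite K"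
  by (meson finite_carrier finite_subset subgroup.subset)

lemma card_subgroup_pos: "subgroup K G \<Longrightarrow> card K > 0"
  using finite_subgroup[of K] subgroup.one_closed[of K G] by (auto simp: card_gt_0_iff)

lemma subgroup_mult_right_iff:
  assumes "subgroup K G" "k \<in> K" "g \<in> carrier G"
  shows "g \<otimes> k \<in> K \<longleftrightarrow> g \<in> K"
proof -
  interpret K: subgroup K G by fact
  have "g \<otimes> k \<otimes> inv k = g"
    using assms by (simp add: m_assoc)
  then show ?thesis
    by (metis K.m_closed K.m_inv_closed \<open>k \<in> K\<close>)
qed

lemma subgroup_mult_left_iff:
  assumes "subgroup K G" "k \<in> K" "g \<in> carrier G"
  shows "k \<otimes> g \<in> K \<longleftrightarrow> g \<in> K"
proof -
  interpret K: subgroup K G by fact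
  have "inv k \<otimes> (k \<otimes> g) = g"
    using assms(2,3) by (simp add: m_assoc[symmetric])
  then show ?thesis
    by (metis K.m_closed K.m_inv_closed \<open>k \<in> K\<close>)
qed

lemma eta_mult_left:
  assumes "subgroup K G" and g: "g \<in> carrier G"
  shows "(eta K \<otimes>\<^bsub>A\<^esub> x) g = (\<Sum>k\<in>K. x (k \<otimes> g)) / of_nat (card K)"
proof -
  interpret K: subgroup K G by fact
  have "(eta K \<otimes>\<^bsub>A\<^esub> x) g = (\<Sum>h\<in>carrier G. eta K h * x (inv h \<otimes> g))"
    using g by (simp add: group_algebra_def)
  also have "\<dots> = (\<Sum>h\<in>K. eta K h * x (inv h \<otimes> g))"
    by (rule sum.mono_neutral_right) (auto simp: finite_carrier eta_def)
  also have "\<dots> = (\<Sum>k\<in>K. x (k \<otimes> g) / of_nat (card K))"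
    by (rule sum.reindex_bij_witness[of _ "\<lambda>k. inv k" "\<lambda>k. inv k"]) (auto simp: eta_def)
  finally show ?thesis by (simp add: sum_divide_distrib)
qed

lemma eta_mult_right:
  assumes "subgroup K G" and g: "g \<in> carrier G"
  shows "(x \<otimes>\<^bsub>A\<^esub> eta K) g = (\<Sum>k\<in>K. x (g \<otimes> k)) / of_nat (card K)"
proof -
  interpret K: subgroup K G by fact
  have cancel: "h \<otimes> (inv h \<otimes> k) = k" "inv h \<otimes> (h \<otimes> k) = k"
    if "h \<in> carrier G" "k \<in> carrier G" for h k
    using that by (simp_all add: m_assoc[symmetric])
  have "(x \<otimes>\<^bsub>A\<^esub> eta K) g = (\<Sum>h\<in>carrier G. x h * eta K (inv h \<otimes> g))"
    using g by (simp add: group_algebra_def)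
  also have "\<dots> = (\<Sum>k\<in>carrier G. x (g \<otimes> k) * eta K (inv k))"
    by (rule sum.reindex_bij_witness[of _ "\<lambda>k. g \<otimes> k" "\<lambda>h. inv g \<otimes> h"])
      (use g in \<open>auto simp: inv_mult_group m_assoc cancel\<close>)
  also have "\<dots> = (\<Sum>k\<in>K. x (g \<otimes> k) * eta K (inv k))"
    by (rule sum.mono_neutral_right) (auto simp: finite_carrier eta_def dest: K.m_inv_closed)
  also have "\<dots> = (\<Sum>k\<in>K. x (g \<otimes> k) / of_nat (card K))"
    by (rule sum.cong) (auto simp: eta_def)
  finally show ?thesis by (simp add: sum_divide_distrib)
qed

lemma eta_mult_left_invariant:
  assumes K: "subgroup K G" and "k \<in> K" "g \<in> carrier G"
  shows "(eta K \<otimes>\<^bsub>A\<^esub> x) (k \<otimes> g) = (eta K \<otimes>\<^bsub>A\<^esub> x) g"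
proof -
  interpret K: subgroup K G by fact
  have "(\<Sum>l\<in>K. x (l \<otimes> (k \<otimes> g))) = (\<Sum>l\<in>K. x (l \<otimes> g))"
    by (rule sum.reindex_bij_witness[of _ "\<lambda>l. l \<otimes> inv k" "\<lambda>l. l \<otimes> k"])
      (use assms(2,3) in \<open>auto simp: m_assoc\<close>)
  then show ?thesis
    using assms by (simp add: eta_mult_left)
qed

lemma eta_mult_right_invariant:
  assumes K: "subgroup K G" and "k \<in> K" "g \<in> carrier G"
  shows "(x \<otimes>\<^bsub>A\<^esub> eta K) (g \<otimes> k) = (x \<otimes>\<^bsub>A\<^esub> eta K) g"
proof -
  interpret K: subgroup K G by fact
  have cancel: "k \<otimes> (inv k \<otimes> l) = l" "inv k \<otimes> (k \<otimes> l) = l" if "l \<in> K" for l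
    using that \<open>k \<in> K\<close> by (simp_all add: m_assoc[symmetric])
  have "(\<Sum>l\<in>K. x (g \<otimes> k \<otimes> l)) = (\<Sum>l\<in>K. x (g \<otimes> l))"
    by (rule sum.reindex_bij_witness[of _ "\<lambda>l. inv k \<otimes> l" "\<lambda>l. k \<otimes> l"])
      (use assms(2,3) in \<open>auto simp: m_assoc cancel\<close>)
  then show ?thesis
    using assms by (simp add: eta_mult_right)
qed

text \<open>Right multiplication by \<open>\<eta>\<^sub>K\<close> replaces each coefficient by the average over its left coset
  of \<open>K\<close>, and a function equals its averages exactly if it is constant on the cosets.\<close>

lemma mult_eta_eq_iff:
  assumes K: "subgroup K G" and x: "x \<in> carrier A"
  shows "x \<otimes>\<^bsub>A\<^esub> eta K = x \<longleftrightarrow> (\<forall>g\<in>carrier G. \<forall>k\<in>K. x (g \<otimes> k) = x g)"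
proof
  assume "x \<otimes>\<^bsub>A\<^esub> eta K = x"
  then show "\<forall>g\<in>carrier G. \<forall>k\<in>K. x (g \<otimes> k) = x g"
    using eta_mult_right_invariant[OF K, of _ _ x] by simp
next
  assume "\<forall>g\<in>carrier G. \<forall>k\<in>K. x (g \<otimes> k) = x g"
  then have "(x \<otimes>\<^bsub>A\<^esub> eta K) g = x g" if "g \<in> carrier G" for g
    using that card_subgroup_pos[OF K] by (simp add: eta_mult_right[OF K])
  moreover have "x \<otimes>\<^bsub>A\<^esub> eta K \<in> carrier A"
    by (simp add: x subgroup.subset[OF K])
  ultimately show "x \<otimes>\<^bsub>A\<^esub> eta K = x"
    using x by (blast intro: group_algebra_ext)
qed

lemma eta_absorb_right:
  assumes T: "subgroup T G" and H: "subgroup H G" and "T \<subseteq> H"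
  shows "eta H \<otimes>\<^bsub>A\<^esub> eta T = eta H"
proof -
  interpret H: subgroup H G by fact
  have "g \<otimes> t \<in> H \<longleftrightarrow> g \<in> H" if "g \<in> carrier G" "t \<in> T" for g t
    using that \<open>T \<subseteq> H\<close> by (auto simp: subgroup_mult_right_iff[OF H])
  then have "\<forall>g\<in>carrier G. \<forall>t\<in>T. eta H (g \<otimes> t) = eta H g"
    by (simp add: eta_def)
  then show ?thesis
    by (simp only: mult_eta_eq_iff[OF T eta_closed[OF H.subset]])
qed

lemma eta_absorb_left:
  assumes T: "subgroup T G" and H: "subgroup H G" and "T \<subseteq> H"
  shows "eta T \<otimes>\<^bsub>A\<^esub> eta H = eta H"
proof -
  interpret H: subgroup H G by fact
  interpret T: subgroup T G by fact
  have "t \<otimes> g \<in> H \<longleftrightarrow> g \<in> H" if "g \<in> carrier G" "t \<in> T" for g t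
    using that \<open>T \<subseteq> H\<close> by (auto simp: subgroup_mult_left_iff[OF H])
  then have "(eta T \<otimes>\<^bsub>A\<^esub> eta H) g = eta H g" if "g \<in> carrier G" for g
    using that card_subgroup_pos[OF T] unfolding eta_mult_left[OF T that] by (simp add: eta_def)
  moreover have "eta T \<otimes>\<^bsub>A\<^esub> eta H \<in> carrier A" "eta H \<in> carrier A"
    by (simp_all add: H.subset T.subset)
  ultimately show ?thesis
    by (blast intro: group_algebra_ext)
qed

section \<open>The left ideal of a subgroup\<close>

text \<open>As \<open>\<eta>\<^sub>T\<close> is idempotent, membership in the ideal that it generates is an equation.\<close>

lemma ideal_eta_eq:
  assumes T: "subgroup T G"
  shows "carrier A #>\<^bsub>A\<^esub> eta T = {x \<in> carrier A. x \<otimes>\<^bsub>A\<^esub> eta T = x}"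
proof -
  have [simp]: "eta T \<in> carrier A" by (simp add: subgroup.subset[OF T])
  show ?thesis
  proof (intro equalityI subsetI)
    fix x assume "x \<in> carrier A #>\<^bsub>A\<^esub> eta T"
    then show "x \<in> {x \<in> carrier A. x \<otimes>\<^bsub>A\<^esub> eta T = x}"
      by (auto simp: r_coset_def A.m_assoc eta_absorb_left[OF T T])
  next
    fix x assume x: "x \<in> {x \<in> carrier A. x \<otimes>\<^bsub>A\<^esub> eta T = x}"
    have "y \<otimes>\<^bsub>A\<^esub> eta T \<in> carrier A #>\<^bsub>A\<^esub> eta T" if "y \<in> carrier A" for y
      using that by (auto simp: r_coset_def)
    from this[of x] x show "x \<in> carrier A #>\<^bsub>A\<^esub> eta T"
      by simp
  qed
qed

text \<open>For idempotent \<open>e\<close> the elements \<open>x\<close> with \<open>x e = x\<close> form the left ideal generated by \<open>e\<close>, so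
  that its stability under \<open>y\<close> needs to be tested at \<open>e\<close> only.\<close>

lemma mult_closed_of_generator:
  assumes "x \<in> carrier A" "e \<in> carrier A" "y \<in> carrier A"
    and eq: "e \<otimes>\<^bsub>A\<^esub> y \<otimes>\<^bsub>A\<^esub> e = e \<otimes>\<^bsub>A\<^esub> y" and x: "x \<otimes>\<^bsub>A\<^esub> e = x"
  shows "x \<otimes>\<^bsub>A\<^esub> y \<otimes>\<^bsub>A\<^esub> e = x \<otimes>\<^bsub>A\<^esub> y"
proof -
  have "x \<otimes>\<^bsub>A\<^esub> y \<otimes>\<^bsub>A\<^esub> e = x \<otimes>\<^bsub>A\<^esub> e \<otimes>\<^bsub>A\<^esub> y \<otimes>\<^bsub>A\<^esub> e"
    by (simp only: x)
  also have "\<dots> = x \<otimes>\<^bsub>A\<^esub> (e \<otimes>\<^bsub>A\<^esub> y \<otimes>\<^bsub>A\<^esub> e)"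
    using assms(1-3) by (simp add: A.m_assoc)
  also have "\<dots> = x \<otimes>\<^bsub>A\<^esub> e \<otimes>\<^bsub>A\<^esub> y"
    unfolding eq using assms(1-3) by (simp add: A.m_assoc)
  finally show ?thesis by (simp only: x)
qed

text \<open>Since \<open>T \<le> H \<le> G\<close>, both \<open>H\<close> and \<open>G\<close> are unions of left cosets of \<open>T\<close>; so \<open>\<eta>\<^sub>G\<close> and the
  restriction to \<open>H\<close> of a function constant on these cosets are again constant on them.  Only the
  stability under \<open>w\<close> is left, and it is tested at the generator \<open>\<eta>\<^sub>T\<close>.\<close>

lemma GL_ideal_eta_iff:
  assumes T: "subgroup T G" and H: "subgroup H G" and TH: "T \<subseteq> H"
  shows "GL_ideal G H w (carrier A #>\<^bsub>A\<^esub> eta T) \<longleftrightarrow>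
    eta T \<otimes>\<^bsub>A\<^esub> weight_elt G w \<otimes>\<^bsub>A\<^esub> eta T = eta T \<otimes>\<^bsub>A\<^esub> weight_elt G w"
    (is "GL_ideal G H w ?L \<longleftrightarrow> ?e \<otimes>\<^bsub>A\<^esub> ?W \<otimes>\<^bsub>A\<^esub> ?e = _")
proof -
  interpret T: subgroup T G by fact
  interpret H: subgroup H G by fact
  have [simp]: "?e \<in> carrier A" by (simp add: T.subset)
  have L: "?L = {x \<in> carrier A. x \<otimes>\<^bsub>A\<^esub> ?e = x}"
    by (rule ideal_eta_eq[OF T])
  have "left_ideal ?L A"
    unfolding left_ideal_def L
  proof (intro conjI ballI)
    show "additive_subgroup {x \<in> carrier A. x \<otimes>\<^bsub>A\<^esub> ?e = x} A"
      by (rule additive_subgroup.intro, rule A.add.subgroupI)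
        (auto simp: A.l_distr A.l_minus intro!: exI[of _ "\<zero>\<^bsub>A\<^esub>"])
  qed (auto simp: A.m_assoc)
  moreover have "eta (carrier G) \<in> ?L"
    unfolding L by (simp add: eta_absorb_right[OF T subgroup_self T.subset])
  moreover have "coord_proj H ` ?L \<subseteq> ?L"
  proof
    fix y assume "y \<in> coord_proj H ` ?L"
    then obtain x where x: "x \<in> carrier A" "x \<otimes>\<^bsub>A\<^esub> ?e = x" and y: "y = coord_proj H x"
      unfolding L by auto
    have yA: "y \<in> carrier A"
      using x(1) unfolding y by (auto simp: group_algebra_def coord_proj_def)
    have "g \<otimes> t \<in> H \<longleftrightarrow> g \<in> H" if "g \<in> carrier G" "t \<in> T" for g t
      using that TH by (auto simp: subgroup_mult_right_iff[OF H])
    then have "y \<otimes>\<^bsub>A\<^esub> ?e = y"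
      using mult_eta_eq_iff[OF T x(1)] x(2) mult_eta_eq_iff[OF T yA]
      unfolding y by (simp add: coord_proj_def)
    with yA show "y \<in> ?L" unfolding L by simp
  qed
  moreover have "?L #>\<^bsub>A\<^esub> ?W \<subseteq> ?L \<longleftrightarrow> ?e \<otimes>\<^bsub>A\<^esub> ?W \<otimes>\<^bsub>A\<^esub> ?e = ?e \<otimes>\<^bsub>A\<^esub> ?W"
  proof
    assume "?L #>\<^bsub>A\<^esub> ?W \<subseteq> ?L"
    moreover have "?e \<in> ?L"
      unfolding L by (simp add: eta_absorb_left[OF T T])
    ultimately have "?e \<otimes>\<^bsub>A\<^esub> ?W \<in> ?L"
      unfolding r_coset_def[of A ?L] by blast
    then show "?e \<otimes>\<^bsub>A\<^esub> ?W \<otimes>\<^bsub>A\<^esub> ?e = ?e \<otimes>\<^bsub>A\<^esub> ?W"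
      unfolding L by simp
  next
    assume eq: "?e \<otimes>\<^bsub>A\<^esub> ?W \<otimes>\<^bsub>A\<^esub> ?e = ?e \<otimes>\<^bsub>A\<^esub> ?W"
    have "x \<otimes>\<^bsub>A\<^esub> ?W \<otimes>\<^bsub>A\<^esub> ?e = x \<otimes>\<^bsub>A\<^esub> ?W" if "x \<in> carrier A" "x \<otimes>\<^bsub>A\<^esub> ?e = x" for x
      by (rule mult_closed_of_generator[OF _ _ _ eq]) (simp_all add: that)
    then show "?L #>\<^bsub>A\<^esub> ?W \<subseteq> ?L"
      unfolding L by (auto simp: r_coset_def)
  qed
  ultimately show ?thesis
    unfolding GL_ideal_def by blast
qed

text \<open>From \<open>\<eta>\<^sub>H \<eta>\<^sub>T = \<eta>\<^sub>H\<close> it follows that right multiplication by \<open>1 - \<eta>\<^sub>H\<close> maps the ideal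
  into itself; there it is the projection onto the kernel of \<open>\<eta>\<^sub>H\<close>.\<close>

lemma ideal_circ_eta_eq:
  assumes T: "subgroup T G" and H: "subgroup H G" and TH: "T \<subseteq> H"
  shows "ideal_circ G H (carrier A #>\<^bsub>A\<^esub> eta T) =
    {x \<in> carrier A. x \<otimes>\<^bsub>A\<^esub> eta T = x \<and> x \<otimes>\<^bsub>A\<^esub> eta H = \<zero>\<^bsub>A\<^esub>}" (is "_ = ?R")
proof -
  have [simp]: "eta T \<in> carrier A" "eta H \<in> carrier A"
    by (simp_all add: T H subgroup.subset)
  have split: "y \<otimes>\<^bsub>A\<^esub> (\<one>\<^bsub>A\<^esub> \<ominus>\<^bsub>A\<^esub> eta H) = y \<ominus>\<^bsub>A\<^esub> y \<otimes>\<^bsub>A\<^esub> eta H" if "y \<in> carrier A" for y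
    using that by (simp add: A.minus_eq A.r_distr A.r_minus)
  show ?thesis
  proof (intro equalityI subsetI)
    fix x assume "x \<in> ideal_circ G H (carrier A #>\<^bsub>A\<^esub> eta T)"
    then obtain y where y: "y \<in> carrier A" "y \<otimes>\<^bsub>A\<^esub> eta T = y"
      and x: "x = y \<ominus>\<^bsub>A\<^esub> y \<otimes>\<^bsub>A\<^esub> eta H"
      unfolding ideal_circ_def ideal_eta_eq[OF T] by (auto simp: r_coset_def split)
    show "x \<in> ?R"
      using y unfolding x
      by (simp add: A.minus_eq A.l_distr A.l_minus A.r_neg A.m_assoc
          eta_absorb_right[OF T H TH] eta_absorb_left[OF H H])
  next
    fix x assume x: "x \<in> ?R"
    then have "x \<otimes>\<^bsub>A\<^esub> (\<one>\<^bsub>A\<^esub> \<ominus>\<^bsub>A\<^esub> eta H) = x"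
      by (auto simp: split) (simp add: A.minus_eq)
    moreover have "x \<otimes>\<^bsub>A\<^esub> (\<one>\<^bsub>A\<^esub> \<ominus>\<^bsub>A\<^esub> eta H) \<in> ideal_circ G H (carrier A #>\<^bsub>A\<^esub> eta T)"
      using x unfolding ideal_circ_def ideal_eta_eq[OF T] by (auto simp: r_coset_def)
    ultimately show "x \<in> ideal_circ G H (carrier A #>\<^bsub>A\<^esub> eta T)"
      by simp
  qed
qed

text \<open>The ideal \<open>L\<degree>\<close> is generated by \<open>\<eta>\<^sub>T - \<eta>\<^sub>H\<close>.  Once \<open>L\<close> is stable under \<open>w\<close>, stability of
  \<open>L\<degree>\<close> only asks that \<open>L\<degree> w\<close> be killed by \<open>\<eta>\<^sub>H\<close>, which for the generator is the second equation.\<close>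

lemma weak_lumping_eta_iff:
  assumes T: "subgroup T G" and H: "subgroup H G" and TH: "T \<subseteq> H"
  shows "weak_lumping_GL_ideal G H w (carrier A #>\<^bsub>A\<^esub> eta T) \<longleftrightarrow>
    eta T \<otimes>\<^bsub>A\<^esub> weight_elt G w \<otimes>\<^bsub>A\<^esub> eta T = eta T \<otimes>\<^bsub>A\<^esub> weight_elt G w \<and>
    eta T \<otimes>\<^bsub>A\<^esub> weight_elt G w \<otimes>\<^bsub>A\<^esub> eta H = eta H \<otimes>\<^bsub>A\<^esub> weight_elt G w \<otimes>\<^bsub>A\<^esub> eta H"
proof -
  let ?e = "eta T" and ?f = "eta H" and ?W = "weight_elt G w"
  let ?L = "carrier A #>\<^bsub>A\<^esub> ?e"
  have [simp]: "?e \<in> carrier A" "?f \<in> carrier A"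
    by (simp_all add: T H subgroup.subset)
  note circ = ideal_circ_eta_eq[OF T H TH]
  have "ideal_circ G H ?L #>\<^bsub>A\<^esub> ?W \<subseteq> ideal_circ G H ?L \<longleftrightarrow>
      ?e \<otimes>\<^bsub>A\<^esub> ?W \<otimes>\<^bsub>A\<^esub> ?f = ?f \<otimes>\<^bsub>A\<^esub> ?W \<otimes>\<^bsub>A\<^esub> ?f"
    if "GL_ideal G H w ?L"
  proof
    assume closed: "ideal_circ G H ?L #>\<^bsub>A\<^esub> ?W \<subseteq> ideal_circ G H ?L"
    have "?e \<ominus>\<^bsub>A\<^esub> ?f \<in> ideal_circ G H ?L"
      by (simp add: circ A.minus_eq A.l_distr A.l_minus A.r_neg eta_absorb_right[OF T H TH]
          eta_absorb_left[OF T H TH] eta_absorb_left[OF H H] eta_absorb_left[OF T T])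
    with closed have "(?e \<ominus>\<^bsub>A\<^esub> ?f) \<otimes>\<^bsub>A\<^esub> ?W \<in> ideal_circ G H ?L"
      by (auto simp: r_coset_def)
    then have "?e \<otimes>\<^bsub>A\<^esub> ?W \<otimes>\<^bsub>A\<^esub> ?f \<ominus>\<^bsub>A\<^esub> ?f \<otimes>\<^bsub>A\<^esub> ?W \<otimes>\<^bsub>A\<^esub> ?f = \<zero>\<^bsub>A\<^esub>"
      by (simp add: circ A.minus_eq A.l_distr A.l_minus)
    then show "?e \<otimes>\<^bsub>A\<^esub> ?W \<otimes>\<^bsub>A\<^esub> ?f = ?f \<otimes>\<^bsub>A\<^esub> ?W \<otimes>\<^bsub>A\<^esub> ?f"
      using A.minus_equality[of "?e \<otimes>\<^bsub>A\<^esub> ?W \<otimes>\<^bsub>A\<^esub> ?f" "\<ominus>\<^bsub>A\<^esub> (?f \<otimes>\<^bsub>A\<^esub> ?W \<otimes>\<^bsub>A\<^esub> ?f)"]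
      by (simp add: A.minus_eq)
  next
    assume eq: "?e \<otimes>\<^bsub>A\<^esub> ?W \<otimes>\<^bsub>A\<^esub> ?f = ?f \<otimes>\<^bsub>A\<^esub> ?W \<otimes>\<^bsub>A\<^esub> ?f"
    have "x \<otimes>\<^bsub>A\<^esub> ?W \<in> ideal_circ G H ?L" if x: "x \<in> ideal_circ G H ?L" for x
    proof -
      have xA: "x \<in> carrier A" and xe: "x \<otimes>\<^bsub>A\<^esub> ?e = x" and xf: "x \<otimes>\<^bsub>A\<^esub> ?f = \<zero>\<^bsub>A\<^esub>"
        using x by (simp_all add: circ)
      have "x \<in> ?L"
        using xA xe by (simp add: ideal_eta_eq[OF T])
      then have "x \<otimes>\<^bsub>A\<^esub> ?W \<in> ?L"
        using \<open>GL_ideal G H w ?L\<close> by (auto simp: GL_ideal_def r_coset_def)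
      moreover have "x \<otimes>\<^bsub>A\<^esub> ?W \<otimes>\<^bsub>A\<^esub> ?f = \<zero>\<^bsub>A\<^esub>"
      proof -
        have "x \<otimes>\<^bsub>A\<^esub> ?W \<otimes>\<^bsub>A\<^esub> ?f = x \<otimes>\<^bsub>A\<^esub> ?e \<otimes>\<^bsub>A\<^esub> ?W \<otimes>\<^bsub>A\<^esub> ?f"
          by (simp only: xe)
        also have "\<dots> = x \<otimes>\<^bsub>A\<^esub> (?e \<otimes>\<^bsub>A\<^esub> ?W \<otimes>\<^bsub>A\<^esub> ?f)"
          using xA by (simp add: A.m_assoc)
        also have "\<dots> = x \<otimes>\<^bsub>A\<^esub> ?f \<otimes>\<^bsub>A\<^esub> ?W \<otimes>\<^bsub>A\<^esub> ?f"
          unfolding eq using xA by (simp add: A.m_assoc)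
        finally show ?thesis by (simp add: xf)
      qed
      ultimately show ?thesis
        unfolding circ unfolding ideal_eta_eq[OF T] by simp
    qed
    then show "ideal_circ G H ?L #>\<^bsub>A\<^esub> ?W \<subseteq> ideal_circ G H ?L"
      by (auto simp: r_coset_def)
  qed
  then show ?thesis
    unfolding weak_lumping_GL_ideal_def GL_ideal_eta_iff[OF T H TH, symmetric] by blast
qed

section \<open>Exact lumping\<close>

text \<open>The real vectors in the ideal generated by \<open>\<eta>\<^sub>T\<close>; see the lemma below.\<close>

definition coset_constant :: "'a set \<Rightarrow> ('a \<Rightarrow> real) set" where
  "coset_constant T = {v \<in> real_vectors G. \<forall>g\<in>carrier G. \<forall>t\<in>T. v (g \<otimes> t) = v g}"

lemma coset_constant_iff:
  assumes T: "subgroup T G" and v: "v \<in> real_vectors G"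
  shows "v \<in> coset_constant T \<longleftrightarrow> weight_elt G v \<otimes>\<^bsub>A\<^esub> eta T = weight_elt G v"
  using v subgroup.mem_carrier[OF T] unfolding mult_eta_eq_iff[OF T weight_elt_closed]
  by (simp add: coset_constant_def weight_elt_def)

lemma row_mult_closed: "row_mult G v P \<in> real_vectors G"
  by (simp add: row_mult_def real_vectors_def)

text \<open>Via the embedding \<open>weight_elt G\<close> of \<open>\<real>\<^sup>G\<close> into \<open>\<complex>[G]\<close>, the transition matrix acts on row
  vectors as right multiplication by \<open>w\<close>, up to the normalising factor \<open>w(G)\<close>.\<close>

lemma weight_elt_row_mult:
  assumes "sum w (carrier G) \<noteq> 0" and "g \<in> carrier G"
  shows "(weight_elt G v \<otimes>\<^bsub>A\<^esub> weight_elt G w) g =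
    of_real (sum w (carrier G)) * weight_elt G (row_mult G v (walk_matrix G w)) g"
proof -
  let ?s = "\<Sum>h\<in>carrier G. v h * w (inv h \<otimes> g)"
  have "row_mult G v (walk_matrix G w) g = ?s / sum w (carrier G)"
    using assms(2) by (simp add: row_mult_def walk_matrix_def sum_divide_distrib)
  then have "?s = sum w (carrier G) * row_mult G v (walk_matrix G w) g"
    using assms(1) by simp
  moreover have "(weight_elt G v \<otimes>\<^bsub>A\<^esub> weight_elt G w) g = of_real ?s"
    using assms(2) by (simp add: group_algebra_def weight_elt_def)
  ultimately show ?thesis
    using assms(2) by (simp add: weight_elt_def del: of_real_sum)
qed

lemma row_mult_coset_constant_iff:
  assumes T: "subgroup T G" and pos: "sum w (carrier G) \<noteq> 0"
  shows "row_mult G v (walk_matrix G w) \<in> coset_constant T \<longleftrightarrow>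
    weight_elt G v \<otimes>\<^bsub>A\<^esub> weight_elt G w \<otimes>\<^bsub>A\<^esub> eta T = weight_elt G v \<otimes>\<^bsub>A\<^esub> weight_elt G w"
  using pos subgroup.mem_carrier[OF T]
  by (simp add: coset_constant_iff[OF T row_mult_closed] mult_eta_eq_iff[OF T]
      weight_elt_row_mult del: of_real_sum)

lemma sum_apply: "(\<Sum>i\<in>S. F i) x = (\<Sum>i\<in>S. F i x)"
  for F :: "'i \<Rightarrow> 'c \<Rightarrow> real"
  by (induction S rule: infinite_finite_induct) auto

lemma mem_lcoset_mult_iff:
  assumes T: "subgroup T G" and "C \<in> lcosets T" "g \<in> carrier G" "t \<in> T"
  shows "g \<otimes> t \<in> C \<longleftrightarrow> g \<in> C"
proof -
  interpret T: subgroup T G by fact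
  obtain a where a: "a \<in> carrier G" "C = a <# T"
    using assms(2) by (auto simp: LCOSETS_def)
  have "y \<in> C \<longleftrightarrow> inv a \<otimes> y \<in> T" if "y \<in> carrier G" for y
    using a that T.lcos_module_imp[OF is_group] T.lcos_module_rev[OF is_group] by blast
  moreover have "inv a \<otimes> (g \<otimes> t) \<in> T \<longleftrightarrow> inv a \<otimes> g \<in> T"
    using subgroup_mult_right_iff[OF T, of t "inv a \<otimes> g"] a assms by (simp add: m_assoc)
  ultimately show ?thesis
    using assms by simp
qed

text \<open>The projections of the uniform distribution to left cosets of \<open>T\<close> are multiples of the
  indicator functions of these cosets, and the latter span the vectors constant on cosets.\<close>

lemma coset_constant_subset_GL_subspace:
  assumes T: "subgroup T G" and V: "V \<in> GL_subspaces G T P"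
  shows "coset_constant T \<subseteq> V"
proof
  interpret T: subgroup T G by fact
  interpret M: module "\<lambda>(c::real) (v::'a \<Rightarrow> real) x. c * v x"
    by (rule module_real_fun)
  fix v assume v: "v \<in> coset_constant T"
  have V': "M.subspace V" "uniform_vec G \<in> V"
      "\<And>C u. C \<in> lcosets\<^bsub>G\<^esub> T \<Longrightarrow> u \<in> V \<Longrightarrow> coord_proj C u \<in> V"
    using V unfolding GL_subspaces_def by auto
  define n where "n = real (card (carrier G))"
  have n: "n \<noteq> 0"
    using finite_carrier one_closed unfolding n_def by auto
  \<comment> \<open>the part of \<open>v\<close> supported on \<open>C\<close>: the entries of the uniform distribution are \<open>1 / n\<close>,
    and \<open>v\<close> takes the same value at all points of \<open>C\<close>\<close>
  define F where "F C = (\<lambda>x. (n * v (SOME c. c \<in> C)) * coord_proj C (uniform_vec G) x)" for C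
  have "(\<Sum>C\<in>lcosets\<^bsub>G\<^esub> T. F C) \<in> V"
    unfolding F_def by (intro M.subspace_sum M.subspace_scale V')
  moreover have "v = (\<Sum>C\<in>lcosets\<^bsub>G\<^esub> T. F C)"
  proof
    fix x
    have fin: "finite (lcosets\<^bsub>G\<^esub> T)"
      using finite_carrier by (simp add: LCOSETS_def)
    show "v x = (\<Sum>C\<in>lcosets\<^bsub>G\<^esub> T. F C) x"
    proof (cases "x \<in> carrier G")
      case False
      then show ?thesis
        using v by (simp add: coset_constant_def real_vectors_def coord_proj_def uniform_vec_def
            F_def sum_apply)
    next
      case x: True
      let ?X = "x <# T"
      have X: "?X \<in> lcosets T" "x \<in> ?X"
        using x T lcos_self by (auto simp: LCOSETS_def)
      have "F C x = 0" if "C \<in> lcosets T - {?X}" for C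
        using that X lcos_disjoint[OF T, of C ?X] by (auto simp: F_def coord_proj_def)
      then have "(\<Sum>C\<in>lcosets\<^bsub>G\<^esub> T. F C) x = F ?X x"
        using X(1) by (simp add: sum_apply sum.remove[OF fin X(1)])
      moreover have "(SOME c. c \<in> ?X) \<in> ?X"
        using X(2) by (rule someI)
      then have "v (SOME c. c \<in> ?X) = v x"
        using v x by (auto simp: l_coset_def coset_constant_def)
      ultimately show ?thesis
        using x X n by (simp add: F_def coord_proj_def uniform_vec_def n_def)
    qed
  qed
  ultimately show "v \<in> V" by simp
qed

lemma coset_constant_in_GL_subspaces:
  assumes T: "subgroup T G"
    and closed: "\<And>v. v \<in> coset_constant T \<Longrightarrow> row_mult G v P \<in> coset_constant T"
  shows "coset_constant T \<in> GL_subspaces G T P"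
proof -
  interpret T: subgroup T G by fact
  have "module.subspace (\<lambda>(c::real) v x. c * v x) (coset_constant T)"
    unfolding module.subspace_def[OF module_real_fun] coset_constant_def
    by (auto simp: real_vectors_def)
  moreover have "uniform_vec G \<in> coset_constant T"
    by (simp add: coset_constant_def real_vectors_def uniform_vec_def)
  moreover have "coord_proj C v \<in> coset_constant T"
    if "C \<in> lcosets T" "v \<in> coset_constant T" for C v
    using that by (simp add: coset_constant_def real_vectors_def coord_proj_def
        mem_lcoset_mult_iff[OF T])
  ultimately show ?thesis
    using closed by (auto simp: GL_subspaces_def coset_constant_def)
qed

lemma sum_lcoset:
  assumes "subgroup T G" "g \<in> carrier G"
  shows "sum v (g <# T) = (\<Sum>t\<in>T. v (g \<otimes> t))"
proof -
  have "g <# T = (\<lambda>t. g \<otimes> t) ` T"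
    by (auto simp: l_coset_def)
  moreover have "inj_on (\<lambda>t. g \<otimes> t) T"
    using assms by (auto simp: inj_on_def subgroup.mem_carrier)
  ultimately show ?thesis
    by (simp add: sum.reindex)
qed

lemma GL_subspace_row_mult:
  "V \<in> GL_subspaces G T P \<Longrightarrow> v \<in> V \<Longrightarrow> row_mult G v P \<in> V"
  by (simp add: GL_subspaces_def)

lemma GL_subspace_diff:
  assumes "V \<in> GL_subspaces G T P" "u \<in> V" "v \<in> V"
  shows "u - v \<in> V"
proof -
  have "(\<lambda>x. u x - v x) \<in> V"
    using assms module.subspace_diff[OF module_real_fun, of V u v]
    by (simp add: GL_subspaces_def fun_diff_def)
  then show ?thesis by (simp add: fun_diff_def)
qed

text \<open>Let \<open>V\<close> be the minimal subspace; it contains all vectors constant on left cosets of \<open>T\<close>.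
  If the walk lumps exactly, then for such a vector \<open>v\<close> the difference between \<open>vP\<close> and its
  coset averages lies in \<open>V\<close> and has coset sums \<open>0\<close>, so it vanishes.  If, conversely, the vectors
  constant on cosets are closed under \<open>P\<close>, they contain \<open>V\<close> by minimality, and a vector constant
  on a coset on which it sums to \<open>0\<close> vanishes there.\<close>

lemma lumps_exactly_iff_row_mult_closed:
  assumes T: "subgroup T G"
  shows "lumps_exactly G T P \<longleftrightarrow>
    (\<forall>v\<in>coset_constant T. row_mult G v P \<in> coset_constant T)"
proof
  interpret T: subgroup T G by fact
  let ?V = "\<Inter> (GL_subspaces G T P)"
  note V = Inter_GL_subspaces[of G T P]
  note sub = coset_constant_subset_GL_subspace[OF T V]
  have card: "real (card T) \<noteq> 0"
    using card_subgroup_pos[OF T] by simp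
  assume lumps: "lumps_exactly G T P"
  show "\<forall>v\<in>coset_constant T. row_mult G v P \<in> coset_constant T"
  proof
    fix v assume "v \<in> coset_constant T"
    define u where "u = row_mult G v P"
    have uV: "u \<in> ?V"
      unfolding u_def using sub \<open>v \<in> coset_constant T\<close> by (intro GL_subspace_row_mult[OF V]) auto
    define a where
      "a = (\<lambda>g. if g \<in> carrier G then (\<Sum>t\<in>T. u (g \<otimes> t)) / real (card T) else 0)"
    have inv: "(\<Sum>t\<in>T. u (g \<otimes> s \<otimes> t)) = (\<Sum>t\<in>T. u (g \<otimes> t))"
      if "g \<in> carrier G" "s \<in> T" for g s
    proof -
      have cancel: "s \<otimes> (inv s \<otimes> t) = t" "inv s \<otimes> (s \<otimes> t) = t" if "t \<in> T" for t
        using that \<open>s \<in> T\<close> by (simp_all add: m_assoc[symmetric])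
      show ?thesis
        by (rule sum.reindex_bij_witness[of _ "\<lambda>t. inv s \<otimes> t" "\<lambda>t. s \<otimes> t"])
          (use that in \<open>auto simp: m_assoc cancel\<close>)
    qed
    have "a \<in> coset_constant T"
      unfolding a_def coset_constant_def real_vectors_def by (simp add: inv)
    then have "a \<in> ?V" using sub by blast
    have "u - a \<in> ?V"
      by (rule GL_subspace_diff[OF V uV \<open>a \<in> ?V\<close>])
    moreover have "sum (u - a) C = 0" if "C \<in> lcosets T" for C
    proof -
      obtain g where g: "g \<in> carrier G" "C = g <# T"
        using \<open>C \<in> lcosets T\<close> by (auto simp: LCOSETS_def)
      have "(\<Sum>t\<in>T. a (g \<otimes> t)) = (\<Sum>t\<in>T. a g)"
        using \<open>a \<in> coset_constant T\<close> g by (simp add: coset_constant_def)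
      also have "\<dots> = (\<Sum>t\<in>T. u (g \<otimes> t))"
        using g card by (simp add: a_def)
      finally show ?thesis
        unfolding g(2) sum_lcoset[OF T g(1)] by (simp add: sum_subtractf)
    qed
    ultimately have "u - a = (\<lambda>g. 0)"
      using lumps unfolding lumps_exactly_def by blast
    then have "u = a"
      by (auto simp: fun_eq_iff)
    with \<open>a \<in> coset_constant T\<close> show "row_mult G v P \<in> coset_constant T"
      by (simp add: u_def)
  qed
next
  interpret T: subgroup T G by fact
  assume "\<forall>v\<in>coset_constant T. row_mult G v P \<in> coset_constant T"
  then have V: "coset_constant T \<in> GL_subspaces G T P"
    by (intro coset_constant_in_GL_subspaces[OF T]) auto
  show "lumps_exactly G T P"
    unfolding lumps_exactly_def
  proof (intro ballI impI ext)
    fix v g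
    assume "v \<in> \<Inter> (GL_subspaces G T P)" and zero: "\<forall>C\<in>lcosets T. sum v C = 0"
    with V have v: "v \<in> coset_constant T" by blast
    show "v g = 0"
    proof (cases "g \<in> carrier G")
      case True
      then have "sum v (g <# T) = 0"
        using zero by (auto simp: LCOSETS_def)
      moreover have "sum v (g <# T) = real (card T) * v g"
        using v True by (simp add: sum_lcoset[OF T] coset_constant_def)
      ultimately show ?thesis
        using card_subgroup_pos[OF T] by simp
    next
      case False
      then show ?thesis
        using v by (simp add: coset_constant_def real_vectors_def)
    qed
  qed
qed

text \<open>The generator \<open>\<eta>\<^sub>T\<close> has real coefficients.  Hence the real vectors constant on cosets already
  test whether the complex ideal generated by \<open>\<eta>\<^sub>T\<close> is stable under \<open>w\<close>.\<close>

lemma lumps_exactly_iff: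
  assumes T: "subgroup T G" and pos: "sum w (carrier G) \<noteq> 0"
  shows "lumps_exactly G T (walk_matrix G w) \<longleftrightarrow>
    eta T \<otimes>\<^bsub>A\<^esub> weight_elt G w \<otimes>\<^bsub>A\<^esub> eta T = eta T \<otimes>\<^bsub>A\<^esub> weight_elt G w"
    (is "_ \<longleftrightarrow> ?e \<otimes>\<^bsub>A\<^esub> ?W \<otimes>\<^bsub>A\<^esub> ?e = _")
proof -
  have [simp]: "?e \<in> carrier A" by (simp add: subgroup.subset[OF T])
  have "(\<forall>v\<in>coset_constant T. row_mult G v (walk_matrix G w) \<in> coset_constant T) \<longleftrightarrow>
      (\<forall>v\<in>coset_constant T. weight_elt G v \<otimes>\<^bsub>A\<^esub> ?W \<otimes>\<^bsub>A\<^esub> ?e = weight_elt G v \<otimes>\<^bsub>A\<^esub> ?W)"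
    by (simp add: row_mult_coset_constant_iff[OF T pos])
  also have "\<dots> \<longleftrightarrow> ?e \<otimes>\<^bsub>A\<^esub> ?W \<otimes>\<^bsub>A\<^esub> ?e = ?e \<otimes>\<^bsub>A\<^esub> ?W"
  proof (intro iffI ballI)
    assume *: "\<forall>v\<in>coset_constant T. weight_elt G v \<otimes>\<^bsub>A\<^esub> ?W \<otimes>\<^bsub>A\<^esub> ?e = weight_elt G v \<otimes>\<^bsub>A\<^esub> ?W"
    define v where "v = (\<lambda>g. if g \<in> T then 1 / real (card T) else 0)"
    have v: "v \<in> real_vectors G" "weight_elt G v = ?e"
      using subgroup.mem_carrier[OF T]
      by (auto simp: v_def real_vectors_def weight_elt_def eta_def fun_eq_iff)
    then have "v \<in> coset_constant T"
      by (simp add: coset_constant_iff[OF T] eta_absorb_left[OF T T])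
    with * v(2) show "?e \<otimes>\<^bsub>A\<^esub> ?W \<otimes>\<^bsub>A\<^esub> ?e = ?e \<otimes>\<^bsub>A\<^esub> ?W"
      by metis
  next
    fix v assume eq: "?e \<otimes>\<^bsub>A\<^esub> ?W \<otimes>\<^bsub>A\<^esub> ?e = ?e \<otimes>\<^bsub>A\<^esub> ?W" and "v \<in> coset_constant T"
    then have ve: "weight_elt G v \<otimes>\<^bsub>A\<^esub> ?e = weight_elt G v"
      using coset_constant_iff[OF T, of v] by (auto simp: coset_constant_def)
    show "weight_elt G v \<otimes>\<^bsub>A\<^esub> ?W \<otimes>\<^bsub>A\<^esub> ?e = weight_elt G v \<otimes>\<^bsub>A\<^esub> ?W"
      by (rule mult_closed_of_generator[OF _ _ _ eq ve]) simp_all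
  qed
  finally show ?thesis
    by (simp add: lumps_exactly_iff_row_mult_closed[OF T])
qed

section \<open>Averages over double cosets\<close>

text \<open>Translation by an element of \<open>K\<close> permutes \<open>D\<close>, so averaging over these translations does
  not change the sum over \<open>D\<close>.\<close>

lemma sum_eta_mult_left:
  assumes K: "subgroup K G" and D: "D \<subseteq> carrier G"
    and inv: "\<And>k d. k \<in> K \<Longrightarrow> d \<in> D \<Longrightarrow> k \<otimes> d \<in> D"
  shows "sum (eta K \<otimes>\<^bsub>A\<^esub> x) D = sum x D"
proof -
  interpret K: subgroup K G by fact
  have "(\<Sum>d\<in>D. x (k \<otimes> d)) = sum x D" if k: "k \<in> K" for k
    by (rule sum.reindex_bij_witness[of _ "\<lambda>d. inv k \<otimes> d" "\<lambda>d. k \<otimes> d"])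
      (use k D in \<open>auto simp: inv m_assoc[symmetric] subset_iff\<close>)
  then have "(\<Sum>k\<in>K. \<Sum>d\<in>D. x (k \<otimes> d)) = of_nat (card K) * sum x D"
    by simp
  moreover have "sum (eta K \<otimes>\<^bsub>A\<^esub> x) D = (\<Sum>d\<in>D. (\<Sum>k\<in>K. x (k \<otimes> d)) / of_nat (card K))"
    using D by (intro sum.cong) (auto simp: eta_mult_left[OF K])
  ultimately show ?thesis
    using card_subgroup_pos[OF K]
    by (simp add: sum_divide_distrib[symmetric] sum.swap[of _ K D])
qed

lemma sum_eta_mult_right:
  assumes K: "subgroup K G" and D: "D \<subseteq> carrier G"
    and inv: "\<And>k d. k \<in> K \<Longrightarrow> d \<in> D \<Longrightarrow> d \<otimes> k \<in> D"
  shows "sum (x \<otimes>\<^bsub>A\<^esub> eta K) D = sum x D"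
proof -
  interpret K: subgroup K G by fact
  have "(\<Sum>d\<in>D. x (d \<otimes> k)) = sum x D" if k: "k \<in> K" for k
    by (rule sum.reindex_bij_witness[of _ "\<lambda>d. d \<otimes> inv k" "\<lambda>d. d \<otimes> k"])
      (use k D in \<open>auto simp: inv m_assoc subset_iff\<close>)
  then have "(\<Sum>k\<in>K. \<Sum>d\<in>D. x (d \<otimes> k)) = of_nat (card K) * sum x D"
    by simp
  moreover have "sum (x \<otimes>\<^bsub>A\<^esub> eta K) D = (\<Sum>d\<in>D. (\<Sum>k\<in>K. x (d \<otimes> k)) / of_nat (card K))"
    using D by (intro sum.cong) (auto simp: eta_mult_right[OF K])
  ultimately show ?thesis
    using card_subgroup_pos[OF K]
    by (simp add: sum_divide_distrib[symmetric] sum.swap[of _ K D])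
qed

lemma double_coset_eq:
  "K #> g <#> H = (\<Union>k\<in>K. \<Union>h\<in>H. {k \<otimes> g \<otimes> h})"
  by (auto simp: r_coset_def set_mult_def)

lemma double_coset_card_pos:
  assumes K: "subgroup K G" and H: "subgroup H G" and g: "g \<in> carrier G"
  shows "card (K #> g <#> H) > 0"
proof -
  have "finite (K #> g <#> H)"
    using finite_subgroup[OF K] finite_subgroup[OF H] by (simp add: double_coset_eq)
  moreover have "K #> g <#> H \<noteq> {}"
    using subgroup.one_closed[OF K] subgroup.one_closed[OF H] by (auto simp: double_coset_eq)
  ultimately show ?thesis by (simp add: card_gt_0_iff)
qed

text \<open>Multiplying by \<open>\<eta>\<^sub>K\<close> on the left and by \<open>\<eta>\<^sub>H\<close> on the right preserves the sum over \<open>KgH\<close>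
  and makes the coefficients constant there; so each of them is the average of \<open>w\<close> over \<open>KgH\<close>.\<close>

lemma eta_mult_eta_apply:
  assumes K: "subgroup K G" and H: "subgroup H G" and g: "g \<in> carrier G"
  shows "(eta K \<otimes>\<^bsub>A\<^esub> weight_elt G w \<otimes>\<^bsub>A\<^esub> eta H) g =
    of_real (sum w (K #> g <#> H) / real (card (K #> g <#> H)))"
proof -
  interpret K: subgroup K G by fact
  interpret H: subgroup H G by fact
  let ?D = "K #> g <#> H" and ?W = "weight_elt G w"
  let ?f = "eta K \<otimes>\<^bsub>A\<^esub> ?W \<otimes>\<^bsub>A\<^esub> eta H"
  have [simp]: "eta K \<in> carrier A" "eta H \<in> carrier A"
    by (simp_all add: K.subset H.subset)
  have D: "?D \<subseteq> carrier G"
    using g by (auto simp: double_coset_eq)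
  have left: "k \<otimes> d \<in> ?D" if k: "k \<in> K" and d: "d \<in> ?D" for k d
  proof -
    obtain k' h where d': "k' \<in> K" "h \<in> H" "d = k' \<otimes> g \<otimes> h"
      using d by (auto simp: double_coset_eq)
    then have "k \<otimes> d = (k \<otimes> k') \<otimes> g \<otimes> h"
      using k g by (simp add: m_assoc)
    then show ?thesis
      using k d' by (auto simp: double_coset_eq)
  qed
  have right: "d \<otimes> h \<in> ?D" if h: "h \<in> H" and d: "d \<in> ?D" for h d
  proof -
    obtain k h' where d': "k \<in> K" "h' \<in> H" "d = k \<otimes> g \<otimes> h'"
      using d by (auto simp: double_coset_eq)
    then have "d \<otimes> h = k \<otimes> g \<otimes> (h' \<otimes> h)"
      using h g by (simp add: m_assoc)
    then show ?thesis
      using h d' by (auto simp: double_coset_eq)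
  qed
  have "?f (k \<otimes> g \<otimes> h) = ?f g" if "k \<in> K" "h \<in> H" for k h
    using that g eta_mult_right_invariant[OF H, of h "k \<otimes> g" "eta K \<otimes>\<^bsub>A\<^esub> ?W"]
      eta_mult_left_invariant[OF K, of k g "?W \<otimes>\<^bsub>A\<^esub> eta H"]
    by (simp add: A.m_assoc)
  then have "sum ?f ?D = (\<Sum>d\<in>?D. ?f g)"
    by (intro sum.cong) (auto simp: double_coset_eq)
  also have "\<dots> = of_nat (card ?D) * ?f g"
    by simp
  finally have "of_nat (card ?D) * ?f g = sum ?f ?D" ..
  also have "\<dots> = sum (eta K \<otimes>\<^bsub>A\<^esub> ?W) ?D"
    by (rule sum_eta_mult_right[OF H D right])
  also have "\<dots> = sum ?W ?D"
    by (rule sum_eta_mult_left[OF K D left])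
  also have "\<dots> = of_real (sum w ?D)"
    using D by (auto simp: weight_elt_def intro!: sum.cong)
  finally show ?thesis
    using double_coset_card_pos[OF K H g] by (simp add: field_simps)
qed

lemma eta_mult_eta_eq_iff:
  assumes T: "subgroup T G" and H: "subgroup H G"
  shows "eta T \<otimes>\<^bsub>A\<^esub> weight_elt G w \<otimes>\<^bsub>A\<^esub> eta H = eta H \<otimes>\<^bsub>A\<^esub> weight_elt G w \<otimes>\<^bsub>A\<^esub> eta H \<longleftrightarrow>
    (\<forall>g\<in>carrier G. sum w (T #> g <#> H) =
      real (card (T #> g <#> H)) / real (card (H #> g <#> H)) * sum w (H #> g <#> H))"
    (is "?l = ?r \<longleftrightarrow> _")
proof -
  have "?l \<in> carrier A" "?r \<in> carrier A"
    by (simp_all add: T H subgroup.subset)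
  then have "?l = ?r \<longleftrightarrow> (\<forall>g\<in>carrier G. ?l g = ?r g)"
    using group_algebra_ext[of ?l ?r] by metis
  also have "\<dots> \<longleftrightarrow> (\<forall>g\<in>carrier G. sum w (T #> g <#> H) / real (card (T #> g <#> H)) =
      sum w (H #> g <#> H) / real (card (H #> g <#> H)))"
    by (simp only: eta_mult_eta_apply[OF T H] eta_mult_eta_apply[OF H H] of_real_eq_iff
        cong: ball_cong)
  also have "\<dots> \<longleftrightarrow> (\<forall>g\<in>carrier G. sum w (T #> g <#> H) =
      real (card (T #> g <#> H)) / real (card (H #> g <#> H)) * sum w (H #> g <#> H))"
    using double_coset_card_pos[OF T H] double_coset_card_pos[OF H H]
    by (intro ball_cong) (auto simp: field_simps)
  finally show ?thesis .
qed

end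

theorem proposition11p1:
  fixes G :: "('a, 'b) monoid_scheme"
    and H T :: "'a set"
    and w :: "'a \<Rightarrow> real"
  assumes "group G" and "finite (carrier G)"
    and "subgroup H G" and "subgroup T G" and "T \<subseteq> H"
    and "weight G w"
  shows "weak_lumping_GL_ideal G H w (carrier (group_algebra G) #>\<^bsub>group_algebra G\<^esub> eta T) \<longleftrightarrow>
      lumps_exactly G T (walk_matrix G w) \<and>
      (\<forall>g\<in>carrier G.
        sum w (T #>\<^bsub>G\<^esub> g <#>\<^bsub>G\<^esub> H) =
          real (card (T #>\<^bsub>G\<^esub> g <#>\<^bsub>G\<^esub> H)) / real (card (H #>\<^bsub>G\<^esub> g <#>\<^bsub>G\<^esub> H)) *
            sum w (H #>\<^bsub>G\<^esub> g <#>\<^bsub>G\<^esub> H))"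
proof -
  interpret finite_group G
    using assms(1,2) by (simp add: finite_group_def finite_group_axioms_def)
  have "sum w (carrier G) > 0"
    using \<open>weight G w\<close> finite_carrier unfolding weight_def
    by (metis less_le sum_nonneg sum_nonneg_eq_0_iff)
  then have "sum w (carrier G) \<noteq> 0" by simp
  then have "lumps_exactly G T (walk_matrix G w) \<longleftrightarrow>
      eta T \<otimes>\<^bsub>A\<^esub> weight_elt G w \<otimes>\<^bsub>A\<^esub> eta T = eta T \<otimes>\<^bsub>A\<^esub> weight_elt G w"
    by (rule lumps_exactly_iff[OF assms(4)])
  then show ?thesis
    using weak_lumping_eta_iff[OF assms(4,3,5), of w] eta_mult_eta_eq_iff[OF assms(4,3), of w]
    by argo
qed

end
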